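(* With the notation of the context, assume $\lambda=\tilde\lambda$. For $i,j\in\{1,2\}$ with $i\neq j$, the following limits hold: $$\lim_{c\to\tilde c^+}\bar x_i(c)=\lim_{c\to\tilde c^+}x_j^*(c)=\tilde s+\frac{(-1)^i}{2\theta}\log\left(\frac{\eta+\xi(\tilde c)}{\eta-\xi(\tilde c)}\right).$$
   Context: Fix $\rho,\sigma>0$, $\tilde c\ge0$, $\lambda\ge\tilde\lambda\ge0$ with $1-\lambda\rho>0$, and $\tilde s\in\mathbb{R}$; the parameter $c$ varies in $]\tilde c,\infty[$. Set $\theta=\sqrt{2\rho/\sigma^2}$ and $\eta=(1-\lambda\rho)/\rho>0$. For $c>0$ let $\xi(c)$ be the unique zero in $(0,\eta)$ of $F(x)=2x+\theta c-\eta\log\frac{\eta+x}{\eta-x}$, and set $\xi(0):=\lim_{c\to0^+}\xi(c)=0$. Let $$\Gamma(c)=\frac{\theta(c-\tilde c)}{4\xi(c)}+\frac{\theta c(\lambda-\tilde\lambda)}{4\eta\xi(c)}+\frac{\lambda-\tilde\lambda}{2\eta}.$$ For $i\in\{1,2\}$ set (writing $\xi=\xi(c)$, $\Gamma=\Gamma(c)$) $$\bar x_i(c)=\tilde s+\frac{(-1)^i}{\theta}\log\Big[\sqrt{\tfrac{\eta+\xi}{\eta-\xi}}\big(\sqrt{\Gamma+1}+\sqrt\Gamma\big)\Big],\qquad x_i^*(c)=\tilde s+\frac{(-1)^i}{\theta}\log\Big[\sqrt{\tfrac{\eta-\xi}{\eta+\xi}}\big(\sqrt{\Gamma+1}+\sqrt\Gamma\big)\Big].$$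 These are the intervention thresholds $\bar x_i$ and target states $x_i^*$ of player $i$ at the Nash equilibrium of index $\tilde s$ in an impulse game on a scaled Brownian motion $\sigma W$ with linear running payoffs, discount rate $\rho$, intervention cost $c+\lambda|\delta|$ and gain $\tilde c+\tilde\lambda|\delta|$ for the opponent. *)

theory Defs
  imports Complex_Main
begin

definition theta :: "real \<Rightarrow> real \<Rightarrow> real" where
  "theta \<rho> \<sigma> = sqrt (2 * \<rho> / \<sigma>\<^sup>2)"

definition eta :: "real \<Rightarrow> real \<Rightarrow> real" where
  "eta \<rho> lam = (1 - lam * \<rho>) / \<rho>"

definition F :: "real \<Rightarrow> real \<Rightarrow> real \<Rightarrow> real \<Rightarrow> real" where
  "F \<theta> \<eta> c x = 2 * x + \<theta> * c - \<eta> * ln ((\<eta> + x) / (\<eta> - x))"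

definition xi_pos :: "real \<Rightarrow> real \<Rightarrow> real \<Rightarrow> real" where
  "xi_pos \<theta> \<eta> c = (THE x. x \<in> {0<..<\<eta>} \<and> F \<theta> \<eta> c x = 0)"

(* Only c \<ge> 0 is meaningful. The function \<open>xi_pos\<close> is specified for c > 0 only; at c = 0 the
   value is its right limit (which equals 0). *)
definition xi :: "real \<Rightarrow> real \<Rightarrow> real \<Rightarrow> real" where
  "xi \<theta> \<eta> c = (if c > 0 then xi_pos \<theta> \<eta> c else Lim (at_right 0) (xi_pos \<theta> \<eta>))"

(* Parameters: c and lam are the fixed and proportional intervention cost, c' and lam' the fixed
   and proportional gain of the opponent. *)
definition Gam :: "real \<Rightarrow> real \<Rightarrow> real \<Rightarrow> real \<Rightarrow> real \<Rightarrow> real \<Rightarrow> real" where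
  "Gam \<rho> \<sigma> c' lam lam' c =
     (let \<theta> = theta \<rho> \<sigma>; \<eta> = eta \<rho> lam; \<xi> = xi \<theta> \<eta> c in
        \<theta> * (c - c') / (4 * \<xi>)
        + \<theta> * c * (lam - lam') / (4 * \<eta> * \<xi>)
        + (lam - lam') / (2 * \<eta>))"

definition xbar :: "real \<Rightarrow> real \<Rightarrow> real \<Rightarrow> real \<Rightarrow> real \<Rightarrow> real \<Rightarrow> nat \<Rightarrow> real \<Rightarrow> real" where
  "xbar \<rho> \<sigma> c' lam lam' s i c =
     (let \<theta> = theta \<rho> \<sigma>; \<eta> = eta \<rho> lam; \<xi> = xi \<theta> \<eta> c; \<Gamma> = Gam \<rho> \<sigma> c' lam lam' c in
        s + (- 1) ^ i / \<theta> * ln (sqrt ((\<eta> + \<xi>) / (\<eta> - \<xi>)) * (sqrt (\<Gamma> + 1) + sqrt \<Gamma>)))"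

definition xstar :: "real \<Rightarrow> real \<Rightarrow> real \<Rightarrow> real \<Rightarrow> real \<Rightarrow> real \<Rightarrow> nat \<Rightarrow> real \<Rightarrow> real" where
  "xstar \<rho> \<sigma> c' lam lam' s i c =
     (let \<theta> = theta \<rho> \<sigma>; \<eta> = eta \<rho> lam; \<xi> = xi \<theta> \<eta> c; \<Gamma> = Gam \<rho> \<sigma> c' lam lam' c in
        s + (- 1) ^ i / \<theta> * ln (sqrt ((\<eta> - \<xi>) / (\<eta> + \<xi>)) * (sqrt (\<Gamma> + 1) + sqrt \<Gamma>)))"

end

theory Submission
  imports Defs
begin

text \<open>
  Write \<open>\<psi>(x) = \<eta> log ((\<eta> + x) / (\<eta> - x)) - 2x\<close>, so that \<open>\<xi>(c)\<close> solves \<open>\<psi>(\<xi>) = \<theta> c\<close>. Since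
  \<open>\<psi>'(x) = 2 x\<^sup>2 / (\<eta>\<^sup>2 - x\<^sup>2)\<close>, the function \<open>\<psi>\<close> increases strictly from \<open>0\<close> to infinity on \<open>[0, \<eta>)\<close>.
  Hence \<open>\<xi>\<close> is its increasing inverse, up to the factor \<open>\<theta>\<close>, and it is continuous from the right,
  also at \<open>c = 0\<close>, where its limit is \<open>0\<close> (\<open>xi_at_right\<close>).

  For equal proportional coefficients \<open>\<Gamma>(c) = \<theta> (c - c') / (4 \<xi>(c))\<close>, and the point is that this
  tends to \<open>0\<close>. For \<open>c' > 0\<close> the denominator stays away from \<open>0\<close>. For \<open>c' = 0\<close> numerator and
  denominator both vanish, but the quotient is \<open>\<psi>(\<xi>) / (4 \<xi>)\<close>, a quarter of a difference
  quotient of \<open>\<psi>\<close> at \<open>0\<close>, and \<open>\<psi>'(0) = 0\<close> (\<open>Gam_at_right\<close>). So \<open>sqrt (\<Gamma> + 1) + sqrt \<Gamma>\<close> tends to \<open>1\<close>, and both limits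
  follow by continuity. The threshold of one player meets the target of the other because the two
  arguments of the square root are reciprocal while the signs \<open>(-1)\<^sup>i\<close> and \<open>(-1)\<^sup>j\<close> are opposite.
\<close>

definition psi :: "real \<Rightarrow> real \<Rightarrow> real" where
  "psi \<eta> x = \<eta> * ln ((\<eta> + x) / (\<eta> - x)) - 2 * x"

lemma F_eq_0_iff: "F \<theta> \<eta> c x = 0 \<longleftrightarrow> psi \<eta> x = \<theta> * c"
  by (auto simp: F_def psi_def)

lemma psi_0 [simp]: "psi \<eta> 0 = 0"
  by (simp add: psi_def)

lemma psi_has_derivative:
  assumes "\<bar>x\<bar> < \<eta>"
  shows "(psi \<eta> has_real_derivative 2 * x\<^sup>2 / (\<eta>\<^sup>2 - x\<^sup>2)) (at x)"
proof -
  have pos: "\<eta> + x > 0" "\<eta> - x > 0" using assms by auto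
  have "((\<lambda>x. \<eta> * (ln (\<eta> + x) - ln (\<eta> - x)) - 2 * x) has_real_derivative
          \<eta> * (1 / (\<eta> + x) + 1 / (\<eta> - x)) - 2) (at x)"
    using pos by (auto intro!: derivative_eq_intros)
  moreover have "\<eta> * (1 / (\<eta> + x) + 1 / (\<eta> - x)) - 2 = 2 * x\<^sup>2 / (\<eta>\<^sup>2 - x\<^sup>2)"
  proof -
    have "\<eta> * \<eta> - x * x = (\<eta> + x) * (\<eta> - x)" by (simp add: algebra_simps)
    then have "\<eta> * \<eta> - x * x \<noteq> 0" using pos by simp
    then show ?thesis using pos by (simp add: field_simps power2_eq_square)
  qed
  ultimately have der: "((\<lambda>x. \<eta> * (ln (\<eta> + x) - ln (\<eta> - x)) - 2 * x) has_real_derivative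
      2 * x\<^sup>2 / (\<eta>\<^sup>2 - x\<^sup>2)) (at x)" by simp
  show ?thesis
  proof (rule has_field_derivative_transform_within_open[OF der])
    show "open {-\<eta><..<\<eta>}" "x \<in> {-\<eta><..<\<eta>}" using pos by auto
  qed (auto simp: psi_def ln_div)
qed

lemma isCont_psi: "\<bar>x\<bar> < \<eta> \<Longrightarrow> isCont (psi \<eta>) x"
  using psi_has_derivative DERIV_isCont by blast

lemma psi_strict_mono:
  assumes "0 \<le> x" "x < y" "y < \<eta>"
  shows "psi \<eta> x < psi \<eta> y"
proof (rule DERIV_pos_imp_increasing_open[OF \<open>x < y\<close>])
  fix z assume z: "x < z" "z < y"
  then have "2 * z\<^sup>2 / (\<eta>\<^sup>2 - z\<^sup>2) > 0"
    using assms by (intro divide_pos_pos) (auto simp: power_strict_mono)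
  moreover have "(psi \<eta> has_real_derivative 2 * z\<^sup>2 / (\<eta>\<^sup>2 - z\<^sup>2)) (at z)"
    using z assms by (intro psi_has_derivative) auto
  ultimately show "\<exists>d. (psi \<eta> has_real_derivative d) (at z) \<and> d > 0" by blast
next
  show "continuous_on {x..y} (psi \<eta>)"
    using assms by (intro continuous_at_imp_continuous_on ballI isCont_psi) auto
qed

lemma psi_less_iff:
  assumes "x \<in> {0..<\<eta>}" "y \<in> {0..<\<eta>}"
  shows "psi \<eta> x < psi \<eta> y \<longleftrightarrow> x < y"
  using assms psi_strict_mono[of x y \<eta>] psi_strict_mono[of y x \<eta>]
  by (cases x y rule: linorder_cases) auto

lemma psi_surj:
  assumes "\<eta> > 0" "a \<ge> 0"
  shows "\<exists>x\<in>{0..<\<eta>}. psi \<eta> x = a"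
proof -
  \<comment> \<open>At this \<open>b\<close> the quotient \<open>(\<eta> + b) / (\<eta> - b)\<close> equals \<open>E\<close>, so \<open>\<psi>(b) = a + 2\<eta> - 2b > a\<close>.\<close>
  define E where "E = exp (a / \<eta> + 2)"
  define b where "b = \<eta> * (E - 1) / (E + 1)"
  have E: "E > 1" using assms by (simp add: E_def add_nonneg_pos)
  have b: "0 \<le> b" "b < \<eta>" using E assms by (auto simp: b_def field_simps)
  have "\<eta> + b = E * (\<eta> - b)" using E by (simp add: b_def field_simps)
  then have "(\<eta> + b) / (\<eta> - b) = E" using b by (simp add: field_simps)
  then have "psi \<eta> b = a + 2 * \<eta> - 2 * b"
    using assms by (simp add: psi_def E_def field_simps)
  then have "a \<le> psi \<eta> b" using b by simp
  moreover have "continuous_on {0..b} (psi \<eta>)"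
    using b by (intro continuous_at_imp_continuous_on ballI isCont_psi) auto
  ultimately obtain x where "0 \<le> x" "x \<le> b" "psi \<eta> x = a"
    using IVT'[of "psi \<eta>" 0 a b] assms b by auto
  then show ?thesis using b by auto
qed

lemma xi_pos_root:
  assumes "\<theta> > 0" "\<eta> > 0" "c > 0"
  shows "xi_pos \<theta> \<eta> c \<in> {0<..<\<eta>}" "psi \<eta> (xi_pos \<theta> \<eta> c) = \<theta> * c"
proof -
  obtain x where x: "x \<in> {0..<\<eta>}" "psi \<eta> x = \<theta> * c"
    using psi_surj[of \<eta> "\<theta> * c"] assms by auto
  have "psi \<eta> x > 0" using x assms by simp
  then have "x \<noteq> 0" by auto
  with x have "x \<in> {0<..<\<eta>} \<and> F \<theta> \<eta> c x = 0" by (auto simp: F_eq_0_iff)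
  moreover have "y = x" if "y \<in> {0<..<\<eta>} \<and> F \<theta> \<eta> c y = 0" for y
    using that x psi_less_iff[of x \<eta> y] psi_less_iff[of y \<eta> x] by (auto simp: F_eq_0_iff)
  ultimately have "xi_pos \<theta> \<eta> c = x" unfolding xi_pos_def by (intro the_equality)
  then show "xi_pos \<theta> \<eta> c \<in> {0<..<\<eta>}" "psi \<eta> (xi_pos \<theta> \<eta> c) = \<theta> * c"
    using x \<open>x \<noteq> 0\<close> by auto
qed

text \<open>
  Right continuity of the inverse of \<open>\<psi>\<close>, stated with an arbitrary solution \<open>x\<close> so that it also
  applies at \<open>c' = 0\<close>, where it computes the limit by which \<^const>\<open>xi\<close> is defined. Monotonicity is
  enough: it keeps \<open>\<xi>(c)\<close> above \<open>x\<close>, and below any given \<open>y > x\<close> as soon as \<open>\<theta> c < \<psi>(y)\<close>.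
\<close>

lemma xi_pos_at_right:
  assumes "\<theta> > 0" "\<eta> > 0" "c' \<ge> 0" and x: "x \<in> {0..<\<eta>}" "psi \<eta> x = \<theta> * c'"
  shows "(xi_pos \<theta> \<eta> \<longlongrightarrow> x) (at_right c')"
proof (rule order_tendstoI)
  fix a assume "a < x"
  have "a < xi_pos \<theta> \<eta> c" if "c > c'" for c
  proof -
    note r = xi_pos_root[of \<theta> \<eta> c]
    have "psi \<eta> x < psi \<eta> (xi_pos \<theta> \<eta> c)" using r that assms by simp
    then have "x < xi_pos \<theta> \<eta> c"
      using psi_less_iff[of x \<eta> "xi_pos \<theta> \<eta> c"] x r that assms by simp
    with \<open>a < x\<close> show ?thesis by simp
  qed
  then show "\<forall>\<^sub>F c in at_right c'. a < xi_pos \<theta> \<eta> c"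
    by (intro eventually_at_rightI[of c' "c' + 1"]) auto
next
  fix a assume "x < a"
  define y where "y = min a ((x + \<eta>) / 2)"
  have y: "x < y" "y \<le> a" "y < \<eta>" using x \<open>x < a\<close> by (auto simp: y_def min_def)
  have "\<theta> * c' < psi \<eta> y" using psi_strict_mono[of x y \<eta>] x y by simp
  then have lt: "c' < psi \<eta> y / \<theta>" using assms by (simp add: field_simps)
  have "xi_pos \<theta> \<eta> c < a" if "c \<in> {c'<..<psi \<eta> y / \<theta>}" for c
  proof -
    note r = xi_pos_root[of \<theta> \<eta> c]
    have "psi \<eta> (xi_pos \<theta> \<eta> c) < psi \<eta> y" using r that assms by (simp add: field_simps)
    then have "xi_pos \<theta> \<eta> c < y"
      using psi_less_iff[of "xi_pos \<theta> \<eta> c" \<eta> y] x y r that assms by simp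
    with y show ?thesis by simp
  qed
  then show "\<forall>\<^sub>F c in at_right c'. xi_pos \<theta> \<eta> c < a"
    by (rule eventually_at_rightI[OF _ lt])
qed

lemma xi_root:
  assumes "\<theta> > 0" "\<eta> > 0" "c \<ge> 0"
  shows "xi \<theta> \<eta> c \<in> {0..<\<eta>}" "psi \<eta> (xi \<theta> \<eta> c) = \<theta> * c"
proof -
  have "xi \<theta> \<eta> 0 = 0"
    using xi_pos_at_right[of \<theta> \<eta> 0 0] assms by (auto simp: xi_def intro: tendsto_Lim)
  then have "xi \<theta> \<eta> c \<in> {0..<\<eta>} \<and> psi \<eta> (xi \<theta> \<eta> c) = \<theta> * c"
    using assms xi_pos_root[of \<theta> \<eta> c] by (cases "c = 0") (auto simp: xi_def)
  then show "xi \<theta> \<eta> c \<in> {0..<\<eta>}" "psi \<eta> (xi \<theta> \<eta> c) = \<theta> * c" by auto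
qed

lemma xi_at_right:
  assumes "\<theta> > 0" "\<eta> > 0" "c' \<ge> 0"
  shows "(xi \<theta> \<eta> \<longlongrightarrow> xi \<theta> \<eta> c') (at_right c')"
proof (rule Lim_transform_eventually)
  show "(xi_pos \<theta> \<eta> \<longlongrightarrow> xi \<theta> \<eta> c') (at_right c')"
    using assms xi_root by (intro xi_pos_at_right) auto
  show "\<forall>\<^sub>F c in at_right c'. xi_pos \<theta> \<eta> c = xi \<theta> \<eta> c"
    using eventually_at_right_less[of c'] by eventually_elim (use assms in \<open>auto simp: xi_def\<close>)
qed

text \<open>
  The quotient \<open>(c - c') / \<xi>(c)\<close> is indeterminate exactly for \<open>c' = 0\<close>. In that case substitute
  \<open>\<theta> c = \<psi>(\<xi>(c))\<close>: the limit is then the derivative of \<open>\<psi>\<close> at \<open>0\<close>.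
\<close>

lemma increment_over_xi_at_right:
  assumes "\<theta> > 0" "\<eta> > 0" "c' \<ge> 0"
  shows "((\<lambda>c. \<theta> * (c - c') / xi \<theta> \<eta> c) \<longlongrightarrow> 0) (at_right c')"
proof (cases "c' = 0")
  case False
  then have "xi \<theta> \<eta> c' \<noteq> 0"
    using xi_root(2)[OF assms] assms by (metis mult_eq_0_iff psi_0 less_irrefl)
  moreover have "((\<lambda>c. \<theta> * (c - c')) \<longlongrightarrow> \<theta> * (c' - c')) (at_right c')"
    by (intro tendsto_intros)
  ultimately show ?thesis
    using tendsto_divide[OF _ xi_at_right[OF assms], of "\<lambda>c. \<theta> * (c - c')" "\<theta> * (c' - c')"] by simp
next
  case True
  have root: "psi \<eta> (xi \<theta> \<eta> c) = \<theta> * c" "xi \<theta> \<eta> c \<noteq> 0" if "c > 0" for c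
    using xi_pos_root[of \<theta> \<eta> c] that assms by (auto simp: xi_def)
  have "xi \<theta> \<eta> 0 = 0"
    using xi_root[of \<theta> \<eta> 0] psi_less_iff[of 0 \<eta> "xi \<theta> \<eta> 0"] assms by auto
  then have lim: "(xi \<theta> \<eta> \<longlongrightarrow> 0) (at_right 0)"
    using xi_at_right[of \<theta> \<eta> 0] assms by simp
  have ev: "\<forall>\<^sub>F c in at_right 0. xi \<theta> \<eta> c \<noteq> 0"
    using eventually_at_right_less[of 0] by eventually_elim (use root in auto)
  have "((\<lambda>x. psi \<eta> x / x) \<longlongrightarrow> 0) (at 0)"
    using psi_has_derivative[of 0 \<eta>] assms by (simp add: has_field_derivative_iff)
  moreover have "filterlim (xi \<theta> \<eta>) (at 0) (at_right 0)"
    using lim ev by (auto simp: filterlim_at)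
  ultimately have "((\<lambda>c. psi \<eta> (xi \<theta> \<eta> c) / xi \<theta> \<eta> c) \<longlongrightarrow> 0) (at_right 0)"
    by (rule filterlim_compose)
  then have "((\<lambda>c. \<theta> * (c - 0) / xi \<theta> \<eta> c) \<longlongrightarrow> 0) (at_right 0)"
  proof (rule Lim_transform_eventually)
    show "\<forall>\<^sub>F c in at_right 0. psi \<eta> (xi \<theta> \<eta> c) / xi \<theta> \<eta> c = \<theta> * (c - 0) / xi \<theta> \<eta> c"
      using eventually_at_right_less[of 0] by eventually_elim (use root in auto)
  qed
  with True show ?thesis by simp
qed

lemma theta_pos: "\<rho> > 0 \<Longrightarrow> \<sigma> > 0 \<Longrightarrow> theta \<rho> \<sigma> > 0"
  by (simp add: theta_def)

lemma eta_pos: "\<rho> > 0 \<Longrightarrow> 1 - lam * \<rho> > 0 \<Longrightarrow> eta \<rho> lam > 0"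
  by (simp add: eta_def)

lemma Gam_at_right:
  assumes "\<rho> > 0" "\<sigma> > 0" "c' \<ge> 0" "1 - lam * \<rho> > 0"
  shows "(Gam \<rho> \<sigma> c' lam lam \<longlongrightarrow> 0) (at_right c')"
proof -
  have "Gam \<rho> \<sigma> c' lam lam =
      (\<lambda>c. theta \<rho> \<sigma> * (c - c') / xi (theta \<rho> \<sigma>) (eta \<rho> lam) c / 4)"
    by (auto simp: Gam_def Let_def)
  moreover have "((\<lambda>c. theta \<rho> \<sigma> * (c - c') / xi (theta \<rho> \<sigma>) (eta \<rho> lam) c / 4) \<longlongrightarrow> 0 / 4)
      (at_right c')"
    using assms by (intro tendsto_intros increment_over_xi_at_right theta_pos eta_pos) auto
  ultimately show ?thesis by simp
qed

theorem proposition4p15: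
  fixes \<rho> \<sigma> c' lam lam' s :: real and i j :: nat
  assumes "\<rho> > 0" and "\<sigma> > 0" and "c' \<ge> 0"
    and "lam \<ge> lam'" and "lam' \<ge> 0" and "1 - lam * \<rho> > 0"
    and "lam = lam'"
    and "i \<in> {1, 2}" and "j \<in> {1, 2}" and "i \<noteq> j"
  defines "\<theta> \<equiv> theta \<rho> \<sigma>" and "\<eta> \<equiv> eta \<rho> lam"
  defines "L \<equiv> s + (- 1) ^ i / (2 * \<theta>) * ln ((\<eta> + xi \<theta> \<eta> c') / (\<eta> - xi \<theta> \<eta> c'))"
  shows "(xbar \<rho> \<sigma> c' lam lam' s i \<longlongrightarrow> L) (at_right c')
       \<and> (xstar \<rho> \<sigma> c' lam lam' s j \<longlongrightarrow> L) (at_right c')"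
proof -
  have \<theta>: "\<theta> > 0" using assms(1,2) by (simp add: \<theta>_def theta_pos)
  have \<eta>: "\<eta> > 0" using assms(1,6) by (simp add: \<eta>_def eta_pos)
  define x where "x = xi \<theta> \<eta> c'"
  have x: "0 \<le> x" "x < \<eta>" using xi_root(1)[OF \<theta> \<eta> assms(3)] by (auto simp: x_def)
  have xi: "(xi \<theta> \<eta> \<longlongrightarrow> x) (at_right c')"
    unfolding x_def by (rule xi_at_right[OF \<theta> \<eta> assms(3)])
  have Gam: "(Gam \<rho> \<sigma> c' lam lam' \<longlongrightarrow> 0) (at_right c')"
    using Gam_at_right assms(1-3,6,7) by simp
  have sign: "(- 1) ^ j = - ((- 1) ^ i :: real)" using assms(8-10) by auto
  have "(xbar \<rho> \<sigma> c' lam lam' s i \<longlongrightarrow>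
      s + (- 1) ^ i / \<theta> * ln (sqrt ((\<eta> + x) / (\<eta> - x)) * (sqrt (0 + 1) + sqrt 0))) (at_right c')"
    unfolding xbar_def Let_def \<theta>_def[symmetric] \<eta>_def[symmetric]
    by (intro tendsto_intros xi Gam) (use x \<theta> in auto)
  moreover have "s + (- 1) ^ i / \<theta> * ln (sqrt ((\<eta> + x) / (\<eta> - x)) * (sqrt (0 + 1) + sqrt 0)) = L"
    using x by (simp add: L_def x_def[symmetric] ln_sqrt)
  moreover have "(xstar \<rho> \<sigma> c' lam lam' s j \<longlongrightarrow>
      s + (- 1) ^ j / \<theta> * ln (sqrt ((\<eta> - x) / (\<eta> + x)) * (sqrt (0 + 1) + sqrt 0))) (at_right c')"
    unfolding xstar_def Let_def \<theta>_def[symmetric] \<eta>_def[symmetric]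
    by (intro tendsto_intros xi Gam) (use x \<theta> in auto)
  moreover have "s + (- 1) ^ j / \<theta> * ln (sqrt ((\<eta> - x) / (\<eta> + x)) * (sqrt (0 + 1) + sqrt 0)) = L"
    using x \<theta> by (simp add: L_def x_def[symmetric] ln_sqrt ln_div sign field_simps)
  ultimately show ?thesis by simp
qed

end
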